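(* Let $\{D_1,\dots,D_m\}$ be a nontrivial $(v,m,k,\lambda)$-SEDF in a finite abelian group $G$ with $m>2$, having the simple character value property with respect to $(a,b)$. Then $$|\widehat{G}^0|=(v-1)\Big(1-\frac{(b^2-a^2)(v-km)m}{4a^2k(m-1)}\Big),$$ $$|\widehat{G}^+|=\frac{(v-1)(v-km)(b^2-a^2)((b-a)m+2a)}{8a^2bk(m-1)},\qquad |\widehat{G}^-|=\frac{(v-1)(v-km)(b^2-a^2)((b+a)m-2a)}{8a^2bk(m-1)},$$ and each of $|\widehat{G}^0|,|\widehat{G}^+|,|\widehat{G}^-|$ is a non-negative integer and $|\widehat{G}^+|+|\widehat{G}^-|>0$.
   Context: Groups are finite abelian, written multiplicatively with identity $1$. For a subset $A\subseteq G$ we also write $A$ for $\sum_{a\in A}a\in\mathbb{Z}[G]$ and $A^{(-1)}=\sum_{a\in A}a^{-1}$. Given integers $m\ge 2$, $k\ge1$, $\lambda\ge 1$ and a group $G$ of order $v$, mutually disjoint $k$-subsets $D_1,\dots,D_m$ form a $(v,m,k,\lambda)$-SEDF in $G$ if $D_j\sum_{i\ne j}D_i^{(-1)}=\lambda(G-1)$ in $\mathbb{Z}[G]$ for each $j$; nontrivial means $k>1$. $\widehat{G}$ is the character group, characters extended linearly to $\mathbb{Z}[G]$. Let $D=\bigcup_iD_i$; $\widehat{G}^0$ is the set of nonprincipal $\chi$ with $\chi(D)=0$ and $\widehat{G}^N$ the set of nonprincipal $\chi$ with $\chi(D)\ne0$. For a nontrivial SEDF with $m>2$ and $\chi\in\widehat{G}^N$,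 $\sqrt{1+4\lambda/|\chi(D)|^2}$ is rational; write it $b_\chi/a_\chi$ with integers $b_\chi>a_\chi>0$, $\gcd(a_\chi,b_\chi)=1$. The SEDF has the simple character value property with respect to $(a,b)$ if $(a_\chi,b_\chi)=(a,b)$ for all $\chi\in\widehat{G}^N$. In that case define $\widehat{G}^+=\{\chi\in\widehat{G}^N:\chi(D_1)=\frac{a+b}{2a}\chi(D)\}$ and $\widehat{G}^-=\{\chi\in\widehat{G}^N:\chi(D_1)=\frac{a-b}{2a}\chi(D)\}$. *)

theory Defs
  imports Complex_Main "HOL-Algebra.Coset" "HOL-Library.Indicator_Function" "HOL-Library.FuncSet" "HOL-Library.Disjoint_Sets"
begin

text \<open>
  An element of the integral group ring of \<open>G\<close> is its coefficient function \<open>'a \<Rightarrow> int\<close>,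
  zero outside \<open>carrier G\<close>.  Addition and integer multiples are pointwise and the product is the
  convolution below.  A subset \<open>A\<close> of the group, viewed in the group ring, is \<open>indicator A\<close>.
\<close>

definition gr_mult :: "('a, 'c) monoid_scheme \<Rightarrow> ('a \<Rightarrow> int) \<Rightarrow> ('a \<Rightarrow> int) \<Rightarrow> 'a \<Rightarrow> int" where
  "gr_mult G f g =
     (\<lambda>x. if x \<in> carrier G then \<Sum>y\<in>carrier G. f y * g (inv\<^bsub>G\<^esub> y \<otimes>\<^bsub>G\<^esub> x) else 0)"

definition inv_set :: "('a, 'c) monoid_scheme \<Rightarrow> 'a set \<Rightarrow> 'a set" where
  "inv_set G A = (\<lambda>x. inv\<^bsub>G\<^esub> x) ` A"

text \<open>The family \<open>D\<close> is indexed by \<open>{1..m}\<close>; its values elsewhere are irrelevant.\<close>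

definition SEDF ::
  "('a, 'c) monoid_scheme \<Rightarrow> nat \<Rightarrow> nat \<Rightarrow> nat \<Rightarrow> nat \<Rightarrow> (nat \<Rightarrow> 'a set) \<Rightarrow> bool" where
  "SEDF G v m k lam D \<longleftrightarrow>
     2 \<le> m \<and> 1 \<le> k \<and> 1 \<le> lam \<and> order G = v \<and>
     (\<forall>i\<in>{1..m}. D i \<subseteq> carrier G \<and> card (D i) = k) \<and>
     disjoint_family_on D {1..m} \<and>
     (\<forall>j\<in>{1..m}.
        gr_mult G (indicator (D j)) (\<lambda>x. \<Sum>i\<in>{1..m} - {j}. indicator (inv_set G (D i)) x) =
        (\<lambda>x. int lam * (indicator (carrier G) x - indicator {\<one>\<^bsub>G\<^esub>} x)))"

definition complex_units :: "complex monoid" where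
  "complex_units = \<lparr>carrier = UNIV - {0}, mult = (*), one = 1\<rparr>"

text \<open>
  Characters are made extensional (fixed to \<open>undefined\<close> outside \<open>carrier G\<close>), so that two
  characters that agree on the group are equal and cardinalities count characters correctly.
\<close>

definition characters :: "('a, 'c) monoid_scheme \<Rightarrow> ('a \<Rightarrow> complex) set" where
  "characters G = hom G complex_units \<inter> extensional (carrier G)"

definition principal_char :: "('a, 'c) monoid_scheme \<Rightarrow> 'a \<Rightarrow> complex" where
  "principal_char G = (\<lambda>x\<in>carrier G. 1)"

text \<open>The linear extension of a character to the group ring.\<close>

definition char_ext :: "('a, 'c) monoid_scheme \<Rightarrow> ('a \<Rightarrow> complex) \<Rightarrow> ('a \<Rightarrow> int) \<Rightarrow> complex" where
  "char_ext G \<chi> f = (\<Sum>x\<in>carrier G. of_int (f x) * \<chi> x)"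

definition family_union :: "nat \<Rightarrow> (nat \<Rightarrow> 'a set) \<Rightarrow> 'a set" where
  "family_union m D = (\<Union>i\<in>{1..m}. D i)"

definition chars_zero ::
  "('a, 'c) monoid_scheme \<Rightarrow> nat \<Rightarrow> (nat \<Rightarrow> 'a set) \<Rightarrow> ('a \<Rightarrow> complex) set" where
  "chars_zero G m D =
     {\<chi> \<in> characters G - {principal_char G}. char_ext G \<chi> (indicator (family_union m D)) = 0}"

definition chars_nonzero ::
  "('a, 'c) monoid_scheme \<Rightarrow> nat \<Rightarrow> (nat \<Rightarrow> 'a set) \<Rightarrow> ('a \<Rightarrow> complex) set" where
  "chars_nonzero G m D =
     {\<chi> \<in> characters G - {principal_char G}. char_ext G \<chi> (indicator (family_union m D)) \<noteq> 0}"

text \<open>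
  The pair \<open>(a\<^sub>\<chi>, b\<^sub>\<chi>)\<close>.  The description is proper exactly when the square root is
  rational and greater than 1; this is the case for every \<open>\<chi> \<in> chars_nonzero G m D\<close> when \<open>D\<close> is
  an SEDF with \<open>m > 2\<close>.
\<close>

definition char_value_pair ::
  "('a, 'c) monoid_scheme \<Rightarrow> nat \<Rightarrow> nat \<Rightarrow> (nat \<Rightarrow> 'a set) \<Rightarrow> ('a \<Rightarrow> complex) \<Rightarrow> int \<times> int" where
  "char_value_pair G m lam D \<chi> =
     (THE (a, b). 0 < a \<and> a < b \<and> coprime a b \<and>
        sqrt (1 + 4 * real lam / (cmod (char_ext G \<chi> (indicator (family_union m D))))\<^sup>2) =
        of_int b / of_int a)"

definition simple_char_value ::
  "('a, 'c) monoid_scheme \<Rightarrow> nat \<Rightarrow> nat \<Rightarrow> (nat \<Rightarrow> 'a set) \<Rightarrow> int \<Rightarrow> int \<Rightarrow> bool" where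
  "simple_char_value G m lam D a b \<longleftrightarrow>
     (\<forall>\<chi>\<in>chars_nonzero G m D. char_value_pair G m lam D \<chi> = (a, b))"

definition chars_plus ::
  "('a, 'c) monoid_scheme \<Rightarrow> nat \<Rightarrow> (nat \<Rightarrow> 'a set) \<Rightarrow> int \<Rightarrow> int \<Rightarrow> ('a \<Rightarrow> complex) set" where
  "chars_plus G m D a b =
     {\<chi> \<in> chars_nonzero G m D. char_ext G \<chi> (indicator (D 1)) =
        (of_int (a + b) / of_int (2 * a)) * char_ext G \<chi> (indicator (family_union m D))}"

definition chars_minus ::
  "('a, 'c) monoid_scheme \<Rightarrow> nat \<Rightarrow> (nat \<Rightarrow> 'a set) \<Rightarrow> int \<Rightarrow> int \<Rightarrow> ('a \<Rightarrow> complex) set" where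
  "chars_minus G m D a b =
     {\<chi> \<in> chars_nonzero G m D. char_ext G \<chi> (indicator (D 1)) =
        (of_int (a - b) / of_int (2 * a)) * char_ext G \<chi> (indicator (family_union m D))}"

end

theory Submission
  imports Defs "HOL-Algebra.Multiplicative_Group"
begin

text \<open>
  For nonprincipal \<open>\<chi>\<close> the defining equation becomes \<open>\<chi>(D\<^sub>j) (cnj \<chi>(D) - cnj \<chi>(D\<^sub>j)) = -\<lambda>\<close>.  If
  \<open>\<chi>(D) \<noteq> 0\<close>, the ratio \<open>\<chi>(D\<^sub>j) / \<chi>(D)\<close> is thus a real root of \<open>X\<^sup>2 - X = \<lambda> / |\<chi>(D)|\<^sup>2\<close>, which puts
  \<open>\<chi>\<close> into the plus or the minus class and determines \<open>|\<chi>(D)|\<close> and \<open>|\<chi>(D\<^sub>1)|\<close> from \<open>(a, b)\<close>;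
  if \<open>\<chi>(D) = 0\<close>, then \<open>|\<chi>(D\<^sub>1)|\<^sup>2 = \<lambda>\<close>.  Parseval for \<open>D\<close> and for \<open>D\<^sub>1\<close>, together with the fact that
  there are \<open>v\<close> characters, gives three linear equations for the three cardinalities.
\<close>

subsection \<open>Characters of finite abelian groups\<close>

lemma complex_nth_root_exists:
  fixes c :: complex
  assumes "n > 0"
  obtains z where "z ^ n = c"
proof
  show "rcis (root n (cmod c)) (Arg c / n) ^ n = c"
    using assms by (simp add: DeMoivre2 rcis_cmod_Arg)
qed

text \<open>The polynomial \<open>z ^ n = 1\<close> has exactly \<open>n > 1\<close> roots, so they
  cannot all be 1. Such a root becomes the value at \<open>x\<close> in
  \<open>characters_separate\<close>.\<close>

lemma nontrivial_root_of_unity_exists: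
  assumes "n > 1"
  obtains z :: complex where "z ^ n = 1" "z \<noteq> 1"
proof -
  have "card {z :: complex. z ^ n = 1} = n"
    using assms by (intro card_roots_unity_eq) auto
  with assms have "\<not> {z :: complex. z ^ n = 1} \<subseteq> {1}"
    using card_mono[of "{1::complex}" "{z. z ^ n = 1}"] by auto
  with that show thesis by auto
qed

section \<open>Extending characters from subgroups\<close>

text \<open>A character of a subgroup \<open>H\<close> is handled without extensionality: its values
  off \<open>H\<close> are free, and it is restricted only once \<open>H\<close> has become the
  whole group.\<close>

lemma partial_char_iff:
  "\<phi> \<in> hom (G\<lparr>carrier := H\<rparr>) complex_units \<longleftrightarrow>
     (\<forall>x\<in>H. \<phi> x \<noteq> 0) \<and> (\<forall>x\<in>H. \<forall>y\<in>H. \<phi> (x \<otimes>\<^bsub>G\<^esub> y) = \<phi> x * \<phi> y)"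
  by (auto simp: hom_def complex_units_def)

lemma (in group) partial_char_int_pow:
  assumes H: "subgroup H G" and phi: "\<phi> \<in> hom (G\<lparr>carrier := H\<rparr>) complex_units" and h: "h \<in> H"
  shows "\<phi> (h [^] (q::int)) = \<phi> h powi q"
proof -
  note p = phi[unfolded partial_char_iff]
  have hG: "h \<in> carrier G" using h subgroup.mem_carrier[OF H] by blast
  have pow: "h [^] (i::int) \<in> H" for i using subgroup_int_pow_closed[OF H h] .
  have step: "\<phi> (h [^] (i + 1)) = \<phi> (h [^] i) * \<phi> h" for i :: int
    using p h pow[of i] hG by (simp add: int_pow_mult)
  have nz: "\<phi> h \<noteq> 0" using p h by blast
  show ?thesis
  proof (induction q rule: int_induct[where k = 0])
    case base
    have "\<phi> \<one> * \<phi> \<one> = \<phi> \<one>" "\<phi> \<one> \<noteq> 0"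
      using p subgroup.one_closed[OF H] by (metis r_one one_closed, blast)
    then show ?case by simp
  next
    case (step1 i)
    then show ?case using step[of i] nz by (simp add: power_int_add)
  next
    case (step2 i)
    then show ?case using step[of "i - 1"] nz by (simp add: power_int_diff field_simps)
  qed
qed

text \<open>The subgroup generated by \<open>H\<close> and \<open>g\<close> consists of the products
  of some \<open>h\<close> in \<open>H\<close> with some \<open>g [^] i\<close>, and the extension
  sends such a product to \<open>\<phi> h * z powi i\<close>. The only obstruction comes from powers
  of \<open>g\<close> inside \<open>H\<close>. Since \<open>n\<close> is the order of
  \<open>g\<close> modulo \<open>H\<close>, the single condition on \<open>z ^ n\<close> removes it.
  Keeping \<open>z\<close> as a parameter allows the value at \<open>g\<close> to be
  prescribed.\<close>

lemma (in comm_group) extend_partial_char: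
  assumes H: "subgroup H G" and phi: "\<phi> \<in> hom (G\<lparr>carrier := H\<rparr>) complex_units"
    and g: "g \<in> carrier G" and n: "n > 0" "g [^] n \<in> H"
    and min: "\<And>i. 0 < i \<Longrightarrow> i < n \<Longrightarrow> g [^] (i::nat) \<notin> H"
    and z: "z ^ n = \<phi> (g [^] n)"
  obtains K \<psi> where "subgroup K G" "H \<subseteq> K" "g \<in> K"
    "\<psi> \<in> hom (G\<lparr>carrier := K\<rparr>) complex_units" "\<And>h. h \<in> H \<Longrightarrow> \<psi> h = \<phi> h" "\<psi> g = z"
proof -
  note p = phi[unfolded partial_char_iff]
  have HG: "\<And>h. h \<in> H \<Longrightarrow> h \<in> carrier G" using subgroup.mem_carrier[OF H] .
  have znz: "z \<noteq> 0" using p n z by (metis power_0_left less_numeral_extra(3))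
  text \<open>By minimality of \<open>n\<close>, a power of \<open>g\<close> in \<open>H\<close> is a power of \<open>g\<^sup>n\<close>; hence \<open>\<psi>\<close> below is well defined.\<close>
  have gpow: "\<phi> (g [^] l) = z powi l" if l: "g [^] l \<in> H" for l :: int
  proof -
    let ?q = "l div int n" and ?r = "nat (l mod int n)"
    have r: "int ?r = l mod int n" using n by simp
    have eq: "(g [^] n) [^] ?q = g [^] (int n * ?q)"
      using g int_pow_pow[of g "int n" ?q] by (simp add: int_pow_int)
    have "g [^] ?r = g [^] (l - int n * ?q)"
      using r by (simp add: minus_mult_div_eq_mod flip: int_pow_int)
    also have "\<dots> = g [^] l \<otimes> inv ((g [^] n) [^] ?q)"
      using g eq by (simp add: int_pow_diff)
    also have "\<dots> \<in> H"
      using H l n subgroup_int_pow_closed[OF H n(2)]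
      by (simp add: subgroup.m_closed subgroup.m_inv_closed)
    finally have "?r = 0"
      using min[of ?r] n by (metis bot_nat_0.not_eq_extremum nat_less_iff of_nat_0_less_iff
          pos_mod_bound pos_mod_sign)
    then have l': "l = int n * ?q" using r by (metis add.right_neutral mult_div_mod_eq of_nat_0)
    have "\<phi> (g [^] l) = \<phi> (g [^] n) powi ?q"
      using eq l' partial_char_int_pow[OF H phi n(2)] by metis
    also have "\<dots> = z powi l"
      using z l' by (metis power_int_mult power_int_of_nat)
    finally show ?thesis .
  qed
  have gz: "g [^] (i::int) \<in> carrier G" for i using g by simp
  \<comment> \<open>Integer exponents make closure under inverses immediate.\<close>
  define K where "K = (\<Union>h\<in>H. range (\<lambda>i::int. h \<otimes> g [^] i))"
  define \<psi> where "\<psi> y = (SOME w. \<exists>h\<in>H. \<exists>i::int. y = h \<otimes> g [^] i \<and> w = \<phi> h * z powi i)" for y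
  have psi: "\<psi> (h \<otimes> g [^] i) = \<phi> h * z powi i" if h: "h \<in> H" for h and i :: int
    unfolding \<psi>_def
  proof (rule some_equality)
    fix w assume "\<exists>h'\<in>H. \<exists>j::int. h \<otimes> g [^] i = h' \<otimes> g [^] j \<and> w = \<phi> h' * z powi j"
    then obtain h' and j :: int where h': "h' \<in> H" and e: "h \<otimes> g [^] i = h' \<otimes> g [^] j"
      and w: "w = \<phi> h' * z powi j" by blast
    \<comment> \<open>Two representations of the same element differ by the power
      \<open>g [^] (j - i)\<close>, which therefore lies in \<open>H\<close>, where
      \<open>gpow\<close> gives its value.\<close>
    have "h = h \<otimes> g [^] i \<otimes> inv (g [^] i)"
      using HG[OF h] gz by (simp add: m_assoc)
    also have "\<dots> = h' \<otimes> g [^] (j - i)"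
      using e HG[OF h'] g by (simp add: m_assoc int_pow_diff)
    finally have hh: "h = h' \<otimes> g [^] (j - i)" .
    then have "g [^] (j - i) = inv h' \<otimes> h"
      using HG[OF h'] gz by (simp add: inv_solve_left)
    then have gH: "g [^] (j - i) \<in> H"
      using H h h' by (simp add: subgroup.m_closed subgroup.m_inv_closed)
    have "\<phi> h = \<phi> h' * z powi (j - i)"
      using hh p h' gH gpow[OF gH] by metis
    then show "w = \<phi> h * z powi i"
      using w znz by (simp add: power_int_diff)
  qed (use h in blast)
  have HK: "H \<subseteq> K"
  proof
    fix h assume "h \<in> H"
    then have "h = h \<otimes> g [^] (0::int)" using HG by simp
    then show "h \<in> K" unfolding K_def using \<open>h \<in> H\<close> by blast
  qed
  have mul: "(h \<otimes> g [^] i) \<otimes> (h' \<otimes> g [^] j) = (h \<otimes> h') \<otimes> g [^] (i + j)"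
    if "h \<in> H" "h' \<in> H" for h h' and i j :: int
    using HG[OF that(1)] HG[OF that(2)] g gz[of i] gz[of j] by (simp add: int_pow_mult m_ac)
  have "subgroup K G"
  proof (rule subgroupI)
    show "K \<subseteq> carrier G" unfolding K_def using HG gz by auto
    show "K \<noteq> {}" using HK subgroup.one_closed[OF H] by blast
    show "inv a \<in> K" if "a \<in> K" for a
    proof -
      from that obtain h and i :: int where h: "h \<in> H" "a = h \<otimes> g [^] i" unfolding K_def by auto
      then have "inv a = inv h \<otimes> g [^] (- i)"
        using HG gz g by (simp add: inv_mult int_pow_neg)
      then show ?thesis unfolding K_def using h subgroup.m_inv_closed[OF H] by blast
    qed
    show "a \<otimes> b \<in> K" if "a \<in> K" "b \<in> K" for a b
    proof -
      from that obtain h h' and i j :: int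
        where h: "h \<in> H" "a = h \<otimes> g [^] i" "h' \<in> H" "b = h' \<otimes> g [^] j" unfolding K_def by auto
      then have "a \<otimes> b = (h \<otimes> h') \<otimes> g [^] (i + j)" using mul by simp
      then show ?thesis unfolding K_def using h subgroup.m_closed[OF H] by blast
    qed
  qed
  moreover have "g \<in> K"
  proof -
    have "g = \<one> \<otimes> g [^] (1::int)" using g by simp
    then show ?thesis unfolding K_def using subgroup.one_closed[OF H] by blast
  qed
  moreover have "\<psi> \<in> hom (G\<lparr>carrier := K\<rparr>) complex_units"
    unfolding partial_char_iff
  proof (intro conjI ballI)
    fix x assume "x \<in> K"
    then obtain h and i :: int where h: "h \<in> H" "x = h \<otimes> g [^] i" unfolding K_def by auto
    then show "\<psi> x \<noteq> 0" using psi p znz by simp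
    fix y assume "y \<in> K"
    then obtain h' and j :: int where h': "h' \<in> H" "y = h' \<otimes> g [^] j" unfolding K_def by auto
    show "\<psi> (x \<otimes> y) = \<psi> x * \<psi> y"
      using h h' mul psi p znz subgroup.m_closed[OF H] by (simp add: power_int_add)
  qed
  moreover have "\<psi> h = \<phi> h" if "h \<in> H" for h
    using psi[OF that, of 0] HG[OF that] by simp
  moreover have "\<psi> g = z"
  proof -
    have "\<phi> \<one> = 1"
      using partial_char_int_pow[OF H phi subgroup.one_closed[OF H], of 0] by simp
    then show ?thesis using psi[of \<one> 1] subgroup.one_closed[OF H] g by simp
  qed
  ultimately show thesis using that HK by blast
qed

text \<open>This \<open>n\<close> is the order of \<open>g\<close> modulo \<open>H\<close>. It
  exists because \<open>g [^] order G = \<one>\<close> lies in \<open>H\<close>.\<close>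

lemma (in group) finite_least_pow_in_subgroup:
  assumes "finite (carrier G)" and H: "subgroup H G" and g: "g \<in> carrier G"
  obtains n :: nat where "n > 0" "g [^] n \<in> H" "\<And>i. 0 < i \<Longrightarrow> i < n \<Longrightarrow> g [^] i \<notin> H"
proof -
  have ex: "order G > 0 \<and> g [^] order G \<in> H"
    using assms pow_order_eq_1[OF g] subgroup.one_closed[OF H] order_gt_0_iff_finite by auto
  define n where "n = (LEAST n. n > 0 \<and> g [^] (n::nat) \<in> H)"
  have "n > 0 \<and> g [^] n \<in> H" unfolding n_def using ex by (rule LeastI)
  moreover have "g [^] i \<notin> H" if "0 < i" "i < n" for i
    using not_less_Least[OF that(2)[unfolded n_def]] that by blast
  ultimately show thesis using that by blast
qed

text \<open>Among the subgroups containing \<open>x\<close> that carry a character nontrivial at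
  \<open>x\<close>, one of largest cardinality must be all of \<open>G\<close>: an element outside
  it would allow an extension to a strictly larger subgroup with the same value at
  \<open>x\<close>.\<close>

lemma (in comm_group) characters_separate:
  assumes fin: "finite (carrier G)" and x: "x \<in> carrier G" "x \<noteq> \<one>"
  obtains \<chi> where "\<chi> \<in> characters G" "\<chi> x \<noteq> 1"
proof -
  define P where "P H \<longleftrightarrow> subgroup H G \<and> x \<in> H \<and>
    (\<exists>\<phi>. \<phi> \<in> hom (G\<lparr>carrier := H\<rparr>) complex_units \<and> \<phi> x \<noteq> 1)" for H
  have "\<exists>H. P H"
  proof -
    have triv: "subgroup {\<one>} G" by (rule triv_subgroup)
    obtain n where n: "n > 0" "x [^] n \<in> {\<one>}" "\<And>i. 0 < i \<Longrightarrow> i < n \<Longrightarrow> x [^] (i::nat) \<notin> {\<one>}"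
      using finite_least_pow_in_subgroup[OF fin triv x(1)] by blast
    \<comment> \<open>Here \<open>n\<close> is the order of \<open>x\<close>. The trivial character
      of \<open>{\<one>}\<close> extends with any \<open>n\<close>-th root of unity as value at
      \<open>x\<close>, and \<open>n > 1\<close> leaves a root other than 1.\<close>
    have "n \<noteq> 1" using n(2) x by auto
    with n(1) obtain z :: complex where z: "z ^ n = 1" "z \<noteq> 1"
      using nontrivial_root_of_unity_exists[of n] by auto
    have "(\<lambda>_. 1) \<in> hom (G\<lparr>carrier := {\<one>}\<rparr>) complex_units"
      by (simp add: partial_char_iff)
    from extend_partial_char[OF triv this x(1) n, of z] z show ?thesis
      unfolding P_def by metis
  qed
  moreover have "\<forall>H. P H \<longrightarrow> card H \<le> card (carrier G)"
    unfolding P_def using fin by (auto intro: card_mono dest: subgroup.subset)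
  ultimately obtain H where H: "P H" and max: "\<And>K. P K \<Longrightarrow> card K \<le> card H"
    using ex_has_greatest_nat[of P _ card "Suc (card (carrier G))"] by (metis le_imp_less_Suc)
  from H obtain \<phi> where sub: "subgroup H G" and xH: "x \<in> H"
    and phi: "\<phi> \<in> hom (G\<lparr>carrier := H\<rparr>) complex_units" "\<phi> x \<noteq> 1"
    unfolding P_def by blast
  have "g \<in> H" if g: "g \<in> carrier G" for g
  proof (rule ccontr)
    assume "g \<notin> H"
    obtain n where n: "n > 0" "g [^] n \<in> H" "\<And>i. 0 < i \<Longrightarrow> i < n \<Longrightarrow> g [^] (i::nat) \<notin> H"
      using finite_least_pow_in_subgroup[OF fin sub g] by blast
    obtain z where z: "z ^ n = \<phi> (g [^] n)" using complex_nth_root_exists[OF n(1)] .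
    obtain K \<psi> where K: "subgroup K G" "H \<subseteq> K" "g \<in> K"
      "\<psi> \<in> hom (G\<lparr>carrier := K\<rparr>) complex_units" "\<And>h. h \<in> H \<Longrightarrow> \<psi> h = \<phi> h"
      using extend_partial_char[OF sub phi(1) g n z] by metis
    have "P K" unfolding P_def using K xH phi by (metis subsetD)
    moreover have "card H < card K"
      using K \<open>g \<notin> H\<close> finite_subset[OF subgroup.subset[OF K(1)] fin]
      by (intro psubset_card_mono) auto
    ultimately show False using max by (meson not_less)
  qed
  then have "H = carrier G" using subgroup.subset[OF sub] by blast
  then have "restrict \<phi> (carrier G) \<in> characters G"
    using phi(1) unfolding characters_def by (auto simp: hom_def complex_units_def)
  then show thesis using that[of "restrict \<phi> (carrier G)"] phi x by simp
qed

section \<open>Elementary properties and orthogonality of characters\<close>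

lemma charactersD:
  assumes "\<chi> \<in> characters G"
  shows "x \<in> carrier G \<Longrightarrow> \<chi> x \<noteq> 0"
    and "x \<in> carrier G \<Longrightarrow> y \<in> carrier G \<Longrightarrow> \<chi> (x \<otimes>\<^bsub>G\<^esub> y) = \<chi> x * \<chi> y"
    and "\<chi> \<in> extensional (carrier G)"
  using assms by (auto simp: characters_def hom_def complex_units_def)

lemma (in group) char_one:
  assumes "\<chi> \<in> characters G" shows "\<chi> \<one> = 1"
  using charactersD(1)[OF assms, of \<one>] charactersD(2)[OF assms, of \<one> \<one>] by simp

lemma (in group) char_pow_order:
  assumes "\<chi> \<in> characters G" "x \<in> carrier G"
  shows "\<chi> x ^ order G = 1"
proof -
  have "\<chi> (x [^] n) = \<chi> x ^ n" for n :: nat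
    using assms by (induction n) (simp_all add: char_one charactersD(2))
  then show ?thesis using pow_order_eq_1[OF assms(2)] char_one[OF assms(1)] by metis
qed

text \<open>The values are roots of unity of exponent \<open>order G\<close>, so extensionality
  places the characters in a finite function space.\<close>

lemma (in group) finite_characters:
  assumes "finite (carrier G)"
  shows "finite (characters G)"
proof (rule finite_subset)
  show "characters G \<subseteq> (carrier G \<rightarrow>\<^sub>E {z. z ^ order G = 1})"
  proof
    fix \<chi> assume "\<chi> \<in> characters G"
    then show "\<chi> \<in> carrier G \<rightarrow>\<^sub>E {z. z ^ order G = 1}"
      using char_pow_order charactersD(3) unfolding PiE_iff by blast
  qed
  have "order G > 0" using assms order_gt_0_iff_finite by blast
  then show "finite (carrier G \<rightarrow>\<^sub>E {z::complex. z ^ order G = 1})"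
    using assms by (intro finite_PiE finite_nth_roots) auto
qed

lemma (in group) norm_char:
  assumes "finite (carrier G)" "\<chi> \<in> characters G" "x \<in> carrier G"
  shows "cmod (\<chi> x) = 1"
  using power_eq_1_iff[OF char_pow_order[OF assms(2,3)]] assms(1) order_gt_0_iff_finite by auto

lemma (in group) char_inv:
  assumes "finite (carrier G)" "\<chi> \<in> characters G" "x \<in> carrier G"
  shows "\<chi> (inv x) = cnj (\<chi> x)"
proof -
  have "\<chi> x * \<chi> (inv x) = 1"
    using assms charactersD(2)[OF assms(2), of x "inv x"] by (simp add: char_one)
  moreover have "\<chi> x * cnj (\<chi> x) = 1"
    using norm_char[OF assms] by (simp flip: complex_norm_square)
  ultimately show ?thesis using charactersD(1)[OF assms(2,3)] by (metis mult_cancel_left)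
qed

lemma (in group) principal_char_in_characters: "principal_char G \<in> characters G"
  by (auto simp: principal_char_def characters_def hom_def complex_units_def)

text \<open>Translating the summation variable by some \<open>y\<close> with
  \<open>\<chi> y \<noteq> 1\<close> multiplies the sum by \<open>\<chi> y\<close> without changing
  it.\<close>

lemma (in group) sum_char:
  assumes fin: "finite (carrier G)" and chi: "\<chi> \<in> characters G"
  shows "(\<Sum>x\<in>carrier G. \<chi> x) = (if \<chi> = principal_char G then of_nat (order G) else 0)"
proof (cases "\<chi> = principal_char G")
  case True
  then show ?thesis by (simp add: principal_char_def order_def)
next
  case False
  then obtain y where y: "y \<in> carrier G" "\<chi> y \<noteq> 1"
    using charactersD(3)[OF chi]
    by (metis (no_types, lifting) principal_char_def extensionalityI restrict_apply restrict_extensional)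
  have "bij_betw (\<lambda>x. y \<otimes> x) (carrier G) (carrier G)"
    using fin y by (simp add: bij_betw_def inj_on_cmult surj_const_mult)
  then have "(\<Sum>x\<in>carrier G. \<chi> x) = (\<Sum>x\<in>carrier G. \<chi> (y \<otimes> x))"
    by (simp add: sum.reindex_bij_betw)
  also have "\<dots> = \<chi> y * (\<Sum>x\<in>carrier G. \<chi> x)"
    using charactersD(2)[OF chi y(1)] by (simp add: sum_distrib_left)
  finally show ?thesis using y False by simp
qed

text \<open>Dual to \<open>sum_char\<close>: multiplication by a character \<open>\<psi>\<close>
  with \<open>\<psi> x \<noteq> 1\<close> permutes the characters. It is injective because
  \<open>\<psi>\<close> has no zeros on the group, and surjective by finiteness.\<close>

lemma (in comm_group) sum_characters_nontrivial:
  assumes fin: "finite (carrier G)" and x: "x \<in> carrier G" "x \<noteq> \<one>"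
  shows "(\<Sum>\<chi>\<in>characters G. \<chi> x) = 0"
proof -
  obtain \<psi> where psi: "\<psi> \<in> characters G" "\<psi> x \<noteq> 1" using characters_separate[OF assms] .
  define T where "T \<chi> = (\<lambda>y\<in>carrier G. \<psi> y * \<chi> y)" for \<chi>
  have "inj_on T (characters G)"
  proof (rule inj_onI)
    fix \<chi> \<chi>' assume c: "\<chi> \<in> characters G" "\<chi>' \<in> characters G" and e: "T \<chi> = T \<chi>'"
    have "\<chi> y = \<chi>' y" if "y \<in> carrier G" for y
      using fun_cong[OF e, of y] that charactersD(1)[OF psi(1) that] unfolding T_def by simp
    then show "\<chi> = \<chi>'" using c charactersD(3) by (metis extensionalityI)
  qed
  moreover have "T ` characters G \<subseteq> characters G"
    using charactersD(1,2) psi(1) unfolding T_def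
    by (auto simp: characters_def hom_def complex_units_def)
  ultimately have "bij_betw T (characters G) (characters G)"
    using finite_characters[OF fin] by (simp add: bij_betw_def endo_inj_surj)
  then have "(\<Sum>\<chi>\<in>characters G. \<chi> x) = (\<Sum>\<chi>\<in>characters G. T \<chi> x)"
    by (simp add: sum.reindex_bij_betw[where g = "\<lambda>\<chi>. \<chi> x"])
  also have "\<dots> = \<psi> x * (\<Sum>\<chi>\<in>characters G. \<chi> x)"
    using x by (simp add: T_def sum_distrib_left)
  finally show ?thesis using psi by simp
qed

text \<open>The double sum of \<open>\<chi> x\<close> over all \<open>\<chi>\<close> and
  \<open>x\<close> is evaluated in both orders: only \<open>x = \<one>\<close> contributes in one,
  only the principal character in the other.\<close>

lemma (in comm_group) card_characters:
  assumes fin: "finite (carrier G)"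
  shows "card (characters G) = order G"
proof -
  have "of_nat (card (characters G)) = (\<Sum>\<chi>\<in>characters G. \<chi> \<one>)"
    by (simp add: char_one)
  also have "\<dots> = (\<Sum>x\<in>carrier G. \<Sum>\<chi>\<in>characters G. \<chi> x)"
    using fin sum_characters_nontrivial[OF fin]
    by (subst sum.remove[of _ \<one>]) auto
  also have "\<dots> = (\<Sum>\<chi>\<in>characters G. \<Sum>x\<in>carrier G. \<chi> x)"
    by (rule sum.swap)
  also have "\<dots> = (\<Sum>\<chi>\<in>characters G. if \<chi> = principal_char G then of_nat (order G) else 0)"
    using sum_char[OF fin] by (intro sum.cong) auto
  also have "\<dots> = of_nat (order G)"
    using finite_characters[OF fin] principal_char_in_characters by simp
  finally show ?thesis by (metis of_nat_eq_iff)
qed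

lemma (in comm_group) sum_characters:
  assumes "finite (carrier G)" "x \<in> carrier G"
  shows "(\<Sum>\<chi>\<in>characters G. \<chi> x) = (if x = \<one> then of_nat (order G) else 0)"
  using assms sum_characters_nontrivial card_characters by (simp add: char_one)

section \<open>Characters on the group ring and Parseval's identity\<close>

lemma char_ext_indicator:
  assumes "finite (carrier G)" "A \<subseteq> carrier G"
  shows "char_ext G \<chi> (indicator A) = (\<Sum>x\<in>A. \<chi> x)"
proof -
  have "char_ext G \<chi> (indicator A) = (\<Sum>x\<in>carrier G. if x \<in> A then \<chi> x else 0)"
    unfolding char_ext_def by (intro sum.cong) (auto simp: indicator_def)
  also have "\<dots> = (\<Sum>x\<in>A. \<chi> x)"
    using assms by (simp add: sum.inter_restrict[symmetric] Int_absorb1)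
  finally show ?thesis .
qed

text \<open>The squared modulus expands into the values \<open>\<chi> (x \<otimes> inv y)\<close>
  over pairs from \<open>A\<close>; summing over the characters keeps only the diagonal.\<close>

lemma (in comm_group) parseval_indicator:
  assumes fin: "finite (carrier G)" and A: "A \<subseteq> carrier G"
  shows "(\<Sum>\<chi>\<in>characters G. (cmod (char_ext G \<chi> (indicator A)))\<^sup>2) = real (order G) * real (card A)"
proof -
  have finA: "finite A" using fin A finite_subset by blast
  have "(\<Sum>\<chi>\<in>characters G. complex_of_real ((cmod (char_ext G \<chi> (indicator A)))\<^sup>2)) =
        (\<Sum>\<chi>\<in>characters G. \<Sum>x\<in>A. \<Sum>y\<in>A. \<chi> (x \<otimes> inv y))"
  proof (intro sum.cong refl)
    fix \<chi> assume chi: "\<chi> \<in> characters G"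
    have "complex_of_real ((cmod (char_ext G \<chi> (indicator A)))\<^sup>2) =
          (\<Sum>x\<in>A. \<chi> x) * (\<Sum>y\<in>A. cnj (\<chi> y))"
      by (simp only: complex_norm_square char_ext_indicator[OF fin A] cnj_sum)
    also have "\<dots> = (\<Sum>x\<in>A. \<Sum>y\<in>A. \<chi> (x \<otimes> inv y))"
      using A chi fin
      by (auto simp: sum_product charactersD(2) char_inv subset_iff intro!: sum.cong)
    finally show "complex_of_real ((cmod (char_ext G \<chi> (indicator A)))\<^sup>2) =
          (\<Sum>x\<in>A. \<Sum>y\<in>A. \<chi> (x \<otimes> inv y))" .
  qed
  also have "\<dots> = (\<Sum>x\<in>A. \<Sum>y\<in>A. \<Sum>\<chi>\<in>characters G. \<chi> (x \<otimes> inv y))"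
    by (simp only: sum.swap[of _ A "characters G"])
  also have "\<dots> = (\<Sum>x\<in>A. \<Sum>y\<in>A. if x = y then of_nat (order G) else 0)"
  proof (intro sum.cong refl)
    fix x y assume "x \<in> A" "y \<in> A"
    then have xy: "x \<in> carrier G" "y \<in> carrier G" using A by auto
    then have "x \<otimes> inv y = \<one> \<longleftrightarrow> x = y"
      by (metis inv_closed inv_equality inv_inv r_inv)
    then show "(\<Sum>\<chi>\<in>characters G. \<chi> (x \<otimes> inv y)) = (if x = y then of_nat (order G) else (0::complex))"
      using sum_characters[OF fin, of "x \<otimes> inv y"] xy by simp
  qed
  also have "\<dots> = of_real (real (order G) * real (card A))"
    using finA by simp
  finally show ?thesis by (simp only: of_real_sum[symmetric] of_real_eq_iff)
qed

text \<open>After interchanging the sums, the substitution of \<open>y \<otimes> x\<close> for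
  \<open>x\<close> separates the two factors.\<close>

lemma (in comm_group) char_ext_gr_mult:
  assumes fin: "finite (carrier G)" and chi: "\<chi> \<in> characters G"
  shows "char_ext G \<chi> (gr_mult G f g) = char_ext G \<chi> f * char_ext G \<chi> g"
proof -
  have "char_ext G \<chi> (gr_mult G f g) =
    (\<Sum>x\<in>carrier G. \<Sum>y\<in>carrier G. of_int (f y * g (inv y \<otimes> x)) * \<chi> x)"
    by (simp add: char_ext_def gr_mult_def sum_distrib_right)
  also have "\<dots> = (\<Sum>y\<in>carrier G. \<Sum>x\<in>carrier G. of_int (f y * g (inv y \<otimes> x)) * \<chi> x)"
    by (rule sum.swap)
  also have "\<dots> = (\<Sum>y\<in>carrier G. of_int (f y) * \<chi> y * char_ext G \<chi> g)"
  proof (intro sum.cong refl)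
    fix y assume y: "y \<in> carrier G"
    have "bij_betw (\<lambda>x. y \<otimes> x) (carrier G) (carrier G)"
      using y by (simp add: bij_betw_def inj_on_cmult surj_const_mult)
    then have "(\<Sum>x\<in>carrier G. of_int (f y * g (inv y \<otimes> x)) * \<chi> x) =
          (\<Sum>x\<in>carrier G. of_int (f y * g (inv y \<otimes> (y \<otimes> x))) * \<chi> (y \<otimes> x))"
      by (rule sum.reindex_bij_betw[symmetric])
    also have "\<dots> = (\<Sum>x\<in>carrier G. of_int (f y) * \<chi> y * (of_int (g x) * \<chi> x))"
      using y chi by (intro sum.cong refl) (simp add: charactersD(2) flip: m_assoc)
    finally show "(\<Sum>x\<in>carrier G. of_int (f y * g (inv y \<otimes> x)) * \<chi> x) =
        of_int (f y) * \<chi> y * char_ext G \<chi> g"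
      by (simp add: char_ext_def sum_distrib_left)
  qed
  finally show ?thesis by (simp add: char_ext_def sum_distrib_right)
qed

lemma (in group) char_ext_inv_set:
  assumes fin: "finite (carrier G)" and chi: "\<chi> \<in> characters G" and A: "A \<subseteq> carrier G"
  shows "char_ext G \<chi> (indicator (inv_set G A)) = cnj (char_ext G \<chi> (indicator A))"
proof -
  have "inv_set G A \<subseteq> carrier G" "inj_on (m_inv G) A"
    using A inj_on_subset[OF inv_inj] by (auto simp: inv_set_def)
  then have "char_ext G \<chi> (indicator (inv_set G A)) = (\<Sum>x\<in>A. \<chi> (inv x))"
    by (simp add: char_ext_indicator[OF fin] inv_set_def sum.reindex)
  also have "\<dots> = cnj (char_ext G \<chi> (indicator A))"
    using A chi fin by (auto simp: char_ext_indicator[OF fin A] char_inv subset_iff intro!: sum.cong)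
  finally show ?thesis .
qed

lemma char_ext_sum: "char_ext G \<chi> (\<lambda>x. \<Sum>i\<in>I. f i x) = (\<Sum>i\<in>I. char_ext G \<chi> (f i))"
  unfolding char_ext_def by (subst sum.swap) (simp add: sum_distrib_right)

subsection \<open>Strong external difference families\<close>

lemma SEDF_blocks:
  assumes sedf: "SEDF G v m k lam D"
  shows "\<And>i. i \<in> {1..m} \<Longrightarrow> D i \<subseteq> carrier G"
    and "\<And>i. i \<in> {1..m} \<Longrightarrow> card (D i) = k"
    and "disjoint_family_on D {1..m}"
    and "order G = v" and "lam > 0"
    and "\<And>j. j \<in> {1..m} \<Longrightarrow>
      gr_mult G (indicator (D j)) (\<lambda>x. \<Sum>i\<in>{1..m} - {j}. indicator (inv_set G (D i)) x) =
        (\<lambda>x. int lam * (indicator (carrier G) x - indicator {\<one>\<^bsub>G\<^esub>} x))"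
  using sedf unfolding SEDF_def by simp_all

lemma char_ext_family_union:
  assumes fin: "finite (carrier G)" and sedf: "SEDF G v m k lam D"
  shows "char_ext G \<chi> (indicator (family_union m D)) =
    (\<Sum>i\<in>{1..m}. char_ext G \<chi> (indicator (D i)))"
proof -
  note sub = SEDF_blocks(1)[OF sedf]
  note disj = SEDF_blocks(3)[OF sedf]
  have "char_ext G \<chi> (indicator (family_union m D)) = (\<Sum>x\<in>(\<Union>i\<in>{1..m}. D i). \<chi> x)"
    unfolding family_union_def using sub by (intro char_ext_indicator fin UN_least)
  also have "\<dots> = (\<Sum>i\<in>{1..m}. \<Sum>x\<in>D i. \<chi> x)"
    using disj finite_subset[OF sub fin] by (intro sum.UNION_disjoint) (auto simp: disjoint_family_on_def)
  also have "\<dots> = (\<Sum>i\<in>{1..m}. char_ext G \<chi> (indicator (D i)))"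
    using sub by (simp add: char_ext_indicator[OF fin])
  finally show ?thesis .
qed

text \<open>The sum of \<open>\<chi>\<close> over the group is left unevaluated so that one equation
  serves both cases: it equals \<open>v\<close> for the principal character, which counts
  differences, and 0 for every other.\<close>

lemma (in comm_group) SEDF_char_equation:
  assumes fin: "finite (carrier G)" and chi: "\<chi> \<in> characters G"
    and sedf: "SEDF G v m k lam D" and j: "j \<in> {1..m}"
  shows "char_ext G \<chi> (indicator (D j)) *
      cnj (char_ext G \<chi> (indicator (family_union m D)) - char_ext G \<chi> (indicator (D j))) =
      of_nat lam * ((\<Sum>x\<in>carrier G. \<chi> x) - 1)"
proof -
  note sub = SEDF_blocks(1)[OF sedf]
  note un = char_ext_family_union[OF fin sedf]
  have rhs: "char_ext G \<chi> (\<lambda>x. int lam * (indicator (carrier G) x - indicator {\<one>} x)) =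
      of_nat lam * ((\<Sum>x\<in>carrier G. \<chi> x) - 1)"
  proof -
    have "char_ext G \<chi> (\<lambda>x. int lam * (indicator (carrier G) x - indicator {\<one>} x)) =
       of_nat lam * (char_ext G \<chi> (indicator (carrier G)) - char_ext G \<chi> (indicator {\<one>}))"
      unfolding char_ext_def
      by (simp add: sum_subtractf[symmetric] sum_distrib_left algebra_simps)
    then show ?thesis by (simp add: char_ext_indicator[OF fin] char_one[OF chi])
  qed
  have "char_ext G \<chi> (indicator (D j)) *
      (\<Sum>i\<in>{1..m} - {j}. cnj (char_ext G \<chi> (indicator (D i)))) =
      of_nat lam * ((\<Sum>x\<in>carrier G. \<chi> x) - 1)"
  proof -
    from arg_cong[OF SEDF_blocks(6)[OF sedf j], of "char_ext G \<chi>"] show ?thesis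
      unfolding char_ext_gr_mult[OF fin chi] rhs char_ext_sum
      using sub by (simp add: char_ext_inv_set[OF fin chi])
  qed
  moreover have "(\<Sum>i\<in>{1..m} - {j}. char_ext G \<chi> (indicator (D i))) =
     char_ext G \<chi> (indicator (family_union m D)) - char_ext G \<chi> (indicator (D j))"
    unfolding un using j by (subst sum.remove[of "{1..m}" j]) auto
  ultimately show ?thesis by (metis cnj_sum)
qed

section \<open>The ratio equation and reduced fractions\<close>

text \<open>The ratio \<open>w = y / x\<close> satisfies
  \<open>w * (1 - cnj w) = - L / (cmod x)\<^sup>2\<close>. The left side has imaginary part
  \<open>Im w\<close>, so \<open>w\<close> is real, and completing the square gives
  \<open>\<bar>2 * Re w - 1\<bar> = s\<close>. The sign is an integer so that signs can later be
  summed over the blocks.\<close>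

lemma quadratic_ratio:
  fixes x y :: complex and L :: real
  assumes x: "x \<noteq> 0" and eq: "y * cnj (x - y) = - of_real L"
  defines "s \<equiv> sqrt (1 + 4 * L / (cmod x)\<^sup>2)"
  shows "\<exists>\<epsilon>::int. \<bar>\<epsilon>\<bar> = 1 \<and> y = of_real ((1 + of_int \<epsilon> * s) / 2) * x"
proof -
  define w where "w = y / x"
  have y: "y = w * x" using x by (simp add: w_def)
  have "w * (1 - cnj w) * of_real ((cmod x)\<^sup>2) = - of_real L"
    using eq unfolding complex_norm_square y by (simp add: algebra_simps)
  then have e: "w * (1 - cnj w) = of_real (- L / (cmod x)\<^sup>2)"
    using x by (simp add: field_simps)
  have im: "Im w = 0" using arg_cong[OF e, of Im] by (simp add: algebra_simps)
  have re: "Re w * (1 - Re w) = - L / (cmod x)\<^sup>2" using arg_cong[OF e, of Re] im by simp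
  have "(2 * Re w - 1)\<^sup>2 = 1 - 4 * (Re w * (1 - Re w))"
    by (simp add: power2_eq_square algebra_simps)
  also have "\<dots> = 1 + 4 * L / (cmod x)\<^sup>2" unfolding re by simp
  finally have "(2 * Re w - 1)\<^sup>2 = 1 + 4 * L / (cmod x)\<^sup>2" .
  then have "s = \<bar>2 * Re w - 1\<bar>" unfolding s_def by (metis real_sqrt_abs)
  then have "Re w = (1 + of_int 1 * s) / 2 \<or> Re w = (1 + of_int (-1) * s) / 2" by (auto simp: abs_if)
  moreover have "w = of_real (Re w)" using im by (simp add: complex_eq_iff)
  ultimately show ?thesis using y by (metis abs_minus_cancel abs_one)
qed

lemma coprime_fraction_unique:
  fixes a b c d :: int
  assumes "0 < a" "0 < c" "coprime a b" "coprime c d"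
    and eq: "real_of_int b / of_int a = of_int d / of_int c"
  shows "a = c \<and> b = d"
proof -
  have "real_of_int (b * c) = real_of_int (d * a)" using eq assms(1,2) by (simp add: field_simps)
  then have e: "b * c = d * a" by (simp only: of_int_eq_iff)
  have "a dvd c" using e assms(3) by (metis coprime_dvd_mult_right_iff dvd_triv_right)
  moreover have "c dvd a" using e assms(4) by (metis coprime_dvd_mult_right_iff dvd_triv_right)
  ultimately have "a = c" using assms(1,2) by (simp add: zdvd_antisym_nonneg)
  then show ?thesis using e assms(1) by simp
qed

text \<open>The definite description yields its defining properties only after existence and
  uniqueness are known. Existence is the reduced form of a rational number greater than 1,
  uniqueness is \<open>coprime_fraction_unique\<close>.\<close>

lemma char_value_pair_of_rational:
  assumes rat: "sqrt (1 + 4 * real lam / (cmod (char_ext G \<chi> (indicator (family_union m D))))\<^sup>2) \<in> \<rat>"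
    and gt: "sqrt (1 + 4 * real lam / (cmod (char_ext G \<chi> (indicator (family_union m D))))\<^sup>2) > 1"
    and ab: "char_value_pair G m lam D \<chi> = (a, b)"
  shows "0 < a \<and> a < b \<and>
    sqrt (1 + 4 * real lam / (cmod (char_ext G \<chi> (indicator (family_union m D))))\<^sup>2) = of_int b / of_int a"
proof -
  let ?s = "sqrt (1 + 4 * real lam / (cmod (char_ext G \<chi> (indicator (family_union m D))))\<^sup>2)"
  define P where "P = (\<lambda>(a::int, b::int). 0 < a \<and> a < b \<and> coprime a b \<and> ?s = of_int b / of_int a)"
  obtain p q :: nat where pq: "q \<noteq> 0" "\<bar>?s\<bar> = real p / real q" "coprime p q"
    using Rats_abs_nat_div_natE[OF rat] by metis
  have s: "?s = real p / real q" using pq(2) gt by simp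
  then have "1 < real p / real q" using gt by (simp only:)
  then have "p > q" using pq(1) by (simp add: field_simps)
  have cop: "coprime (int q) (int p)" using pq(3) by (simp add: coprime_commute)
  have "P (int q, int p)" unfolding P_def using \<open>p > q\<close> pq(1) s cop by simp
  moreover have "z = (int q, int p)" if "P z" for z
  proof (cases z)
    case (Pair c d)
    then have "0 < c" "coprime c d" "?s = of_int d / of_int c" using that by (simp_all only: P_def split_conv)
    moreover have "?s = of_int (int p) / of_int (int q)" using s by simp
    ultimately have "c = int q \<and> d = int p"
      using pq(1) cop by (intro coprime_fraction_unique) (simp_all only: of_nat_0_less_iff neq0_conv)
    then show ?thesis using Pair by simp
  qed
  ultimately have "\<exists>!z. P z" by blast
  then have "P (THE z. P z)" by (rule theI')
  moreover have "(THE z. P z) = (a, b)" using ab unfolding char_value_pair_def P_def .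
  ultimately show ?thesis unfolding P_def by auto
qed

text \<open>The system solved here consists of the character count, the Parseval identities for
  \<open>D\<close> and \<open>D\<^sub>1\<close>, and the count of differences.\<close>

lemma character_count_system:
  fixes a b k m v L n0 p q :: real
  assumes ab: "0 < a" "a < b" and pos: "0 < k" "1 < m" "1 < v" "0 < L"
    and cnt: "v = 1 + n0 + p + q"
    and parD: "(k * m)\<^sup>2 + (p + q) * (4 * L * a\<^sup>2 / (b\<^sup>2 - a\<^sup>2)) = v * (k * m)"
    and par1: "k\<^sup>2 + n0 * L + p * (L * (b + a) / (b - a)) + q * (L * (b - a) / (b + a)) = v * k"
    and diffs: "k\<^sup>2 * (m - 1) = L * (v - 1)"
  shows "n0 = (v - 1) * (1 - ((b^2 - a^2) * (v - k * m) * m) / (4 * a^2 * k * (m - 1)))"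
    and "p = ((v - 1) * (v - k * m) * (b^2 - a^2) * ((b - a) * m + 2 * a)) / (8 * a^2 * b * k * (m - 1))"
    and "q = ((v - 1) * (v - k * m) * (b^2 - a^2) * ((b + a) * m - 2 * a)) / (8 * a^2 * b * k * (m - 1))"
proof -
  \<comment> \<open>The factor common to the closed forms of \<open>p\<close> and \<open>q\<close>;
    by \<open>diffs\<close>, \<open>L * C = k * (v - k * m)\<close>.\<close>
  define C where "C = (v - 1) * (v - k * m) / (k * (m - 1))"
  have nz: "b - a \<noteq> 0" "b + a \<noteq> 0" "k \<noteq> 0" "m - 1 \<noteq> 0" "v - 1 \<noteq> 0" "L \<noteq> 0" "a \<noteq> 0" "b \<noteq> 0"
    using ab pos by auto
  have ba: "b\<^sup>2 - a\<^sup>2 = (b - a) * (b + a)" by (simp add: power2_eq_square algebra_simps)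
  have ba0: "b\<^sup>2 - a\<^sup>2 \<noteq> 0" using nz ba by simp
  have L: "L = k\<^sup>2 * (m - 1) / (v - 1)" using diffs nz by (simp add: field_simps)
  have "(p + q) * (4 * L * a\<^sup>2) = k * m * (v - k * m) * (b\<^sup>2 - a\<^sup>2)"
    using parD ba0 by (simp add: field_simps power2_eq_square)
  then have "p + q = k * m * (v - k * m) * (b\<^sup>2 - a\<^sup>2) / (4 * L * a\<^sup>2)"
    using nz by (simp add: eq_divide_eq)
  also have "\<dots> = C * m * (b\<^sup>2 - a\<^sup>2) / (4 * a\<^sup>2)"
    unfolding C_def L using nz by (simp add: divide_simps) (simp add: power2_eq_square)
  finally have S: "p + q = C * m * (b\<^sup>2 - a\<^sup>2) / (4 * a\<^sup>2)" .
  \<comment> \<open>Eliminating \<open>n0\<close> through \<open>cnt\<close> subtracts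
    \<open>L\<close> from the coefficient of every class; the zero class, whose coefficient is
    \<open>L\<close>, drops out.\<close>
  have "L * (p * ((b + a) / (b - a) - 1) + q * ((b - a) / (b + a) - 1)) = v * k - k\<^sup>2 - L * (v - 1)"
    using par1 cnt by (simp add: algebra_simps)
  also have "\<dots> = k * (v - k * m)" using diffs by (simp add: algebra_simps power2_eq_square)
  also have "\<dots> = L * C"
    unfolding C_def L using nz by (simp add: divide_simps) (simp add: power2_eq_square)
  finally have "C = p * ((b + a) / (b - a) - 1) + q * ((b - a) / (b + a) - 1)" using nz by simp
  also have "(b + a) / (b - a) - 1 = 2 * a / (b - a)" using nz by (simp add: field_simps)
  also have "(b - a) / (b + a) - 1 = - 2 * a / (b + a)" using nz by (simp add: field_simps)
  finally have T: "2 * a * (p * (b + a) - q * (b - a)) = C * (b\<^sup>2 - a\<^sup>2)"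
    unfolding ba using nz by (simp add: divide_simps) (simp add: algebra_simps)
  \<comment> \<open>\<open>S\<close> fixes \<open>p + q\<close> and \<open>T\<close> a weighted
    difference; the combination is chosen so that \<open>q\<close> cancels. The one for
    \<open>q\<close> below cancels \<open>p\<close>.\<close>
  have "4 * a * b * p = 2 * a * (p * (b + a) - q * (b - a)) + 2 * a * (b - a) * (p + q)"
    by (simp add: algebra_simps)
  also have "\<dots> = C * (b\<^sup>2 - a\<^sup>2) * ((b - a) * m + 2 * a) / (2 * a)"
    unfolding T S using nz by (simp add: field_simps power2_eq_square)
  finally have "p = C * (b\<^sup>2 - a\<^sup>2) * ((b - a) * m + 2 * a) / (8 * a\<^sup>2 * b)"
    using nz by (simp add: field_simps power2_eq_square)
  then show "p = ((v - 1) * (v - k * m) * (b^2 - a^2) * ((b - a) * m + 2 * a)) / (8 * a^2 * b * k * (m - 1))"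
    by (simp add: C_def mult_ac)
  have "4 * a * b * q = 2 * a * (b + a) * (p + q) - 2 * a * (p * (b + a) - q * (b - a))"
    by (simp add: algebra_simps)
  also have "\<dots> = C * (b\<^sup>2 - a\<^sup>2) * ((b + a) * m - 2 * a) / (2 * a)"
    unfolding T S using nz by (simp add: field_simps power2_eq_square)
  finally have "q = C * (b\<^sup>2 - a\<^sup>2) * ((b + a) * m - 2 * a) / (8 * a\<^sup>2 * b)"
    using nz by (simp add: field_simps power2_eq_square)
  then show "q = ((v - 1) * (v - k * m) * (b^2 - a^2) * ((b + a) * m - 2 * a)) / (8 * a^2 * b * k * (m - 1))"
    by (simp add: C_def mult_ac)
  have "n0 = (v - 1) - C * m * (b\<^sup>2 - a\<^sup>2) / (4 * a\<^sup>2)" using cnt S by simp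
  also have "C * m * (b\<^sup>2 - a\<^sup>2) / (4 * a\<^sup>2) =
      (v - 1) * ((b^2 - a^2) * (v - k * m) * m / (4 * a^2 * k * (m - 1)))"
    by (simp add: C_def mult_ac)
  finally show "n0 = (v - 1) * (1 - ((b^2 - a^2) * (v - k * m) * m) / (4 * a^2 * k * (m - 1)))"
    by (simp only: right_diff_distrib mult_1_right)
qed

section \<open>Counting in a nontrivial SEDF with more than two blocks\<close>

locale nontrivial_SEDF = comm_group G for G :: "('a, 'c) monoid_scheme" (structure) +
  fixes v m k lam :: nat and D :: "nat \<Rightarrow> 'a set"
  assumes fin: "finite (carrier G)" and sedf: "SEDF G v m k lam D" and k: "k > 1" and m: "m > 2"
begin

abbreviation chD :: "('a \<Rightarrow> complex) \<Rightarrow> complex" where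
  "chD \<chi> \<equiv> char_ext G \<chi> (indicator (family_union m D))"

abbreviation chB :: "('a \<Rightarrow> complex) \<Rightarrow> nat \<Rightarrow> complex" where
  "chB \<chi> j \<equiv> char_ext G \<chi> (indicator (D j))"

lemmas blocks = SEDF_blocks[OF sedf]

lemma union_subset: "family_union m D \<subseteq> carrier G"
  unfolding family_union_def using blocks(1) by (rule UN_least)

lemma card_union: "card (family_union m D) = k * m"
proof -
  have "card (family_union m D) = (\<Sum>i\<in>{1..m}. card (D i))"
    unfolding family_union_def using blocks(3) finite_subset[OF blocks(1) fin]
    by (intro card_UN_disjoint) (auto simp: disjoint_family_on_def)
  then show ?thesis using blocks(2) by simp
qed

lemma char_ext_principal:
  assumes "A \<subseteq> carrier G"
  shows "char_ext G (principal_char G) (indicator A) = of_nat (card A)"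
proof -
  have "char_ext G (principal_char G) (indicator A) = (\<Sum>x\<in>A. 1)"
    unfolding char_ext_indicator[OF fin assms] principal_char_def
    using assms by (intro sum.cong) auto
  then show ?thesis by simp
qed

lemma one_index: "1 \<in> {1..m}"
  using m by simp

text \<open>The principal character turns the equation for one block into
  \<open>k * (k * m - k) = lam * (v - 1)\<close>.\<close>

lemma count_differences: "(real k)\<^sup>2 * (real m - 1) = real lam * (real v - 1)"
proof -
  have "of_nat k * (of_nat (k * m) - of_nat k) = (of_nat lam * (of_nat v - 1) :: complex)"
    using SEDF_char_equation[OF fin principal_char_in_characters sedf one_index]
    unfolding char_ext_principal[OF union_subset] char_ext_principal[OF blocks(1)[OF one_index]]
      blocks(2)[OF one_index] card_union sum_char[OF fin principal_char_in_characters] blocks(4)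
    by simp
  then have "complex_of_real ((real k)\<^sup>2 * (real m - 1)) = complex_of_real (real lam * (real v - 1))"
    by (simp add: power2_eq_square algebra_simps)
  then show ?thesis by (simp only: of_real_eq_iff)
qed

lemma v_gt_1: "v > 1"
proof -
  have "k \<le> order G"
    using card_mono[OF fin blocks(1)[OF one_index]] blocks(2)[OF one_index] by (simp add: order_def)
  then show ?thesis using blocks(4) k by simp
qed

lemma nonprincipal_equation:
  assumes "\<chi> \<in> characters G - {principal_char G}" "j \<in> {1..m}"
  shows "chB \<chi> j * cnj (chD \<chi> - chB \<chi> j) = - of_real (real lam)"
  using SEDF_char_equation[OF fin _ sedf assms(2), of \<chi>] assms(1) by (simp add: sum_char[OF fin])

section \<open>The square root attached to a character and its rationality\<close>

text \<open>The real number whose reduced form is the pair of \<open>\<chi>\<close>, named so that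
  it can be used before rationality is established.\<close>

definition value_root :: "('a \<Rightarrow> complex) \<Rightarrow> real" where
  "value_root \<chi> = sqrt (1 + 4 * real lam / (cmod (chD \<chi>))\<^sup>2)"

lemma value_root_gt_1:
  assumes "\<chi> \<in> chars_nonzero G m D"
  shows "value_root \<chi> > 1"
  using assms blocks(5) by (simp add: value_root_def chars_nonzero_def)

lemma block_value:
  assumes "\<chi> \<in> chars_nonzero G m D" "j \<in> {1..m}"
  shows "\<exists>\<epsilon>::int. \<bar>\<epsilon>\<bar> = 1 \<and> chB \<chi> j = of_real ((1 + of_int \<epsilon> * value_root \<chi>) / 2) * chD \<chi>"
  unfolding value_root_def using assms
  by (intro quadratic_ratio nonprincipal_equation) (auto simp: chars_nonzero_def)

text \<open>Summing the block values \<open>(1 \<plusminus> s) / 2\<close> over all blocks gives 1, so \<open>s = value_root \<chi>\<close> is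
  \<open>2 - m\<close> divided by an integer; this is where \<open>m \<noteq> 2\<close> enters.\<close>

lemma value_root_rational:
  assumes chi: "\<chi> \<in> chars_nonzero G m D"
  shows "value_root \<chi> \<in> \<rat>"
proof -
  obtain \<epsilon> :: "nat \<Rightarrow> int" where \<epsilon>:
    "\<And>j. j \<in> {1..m} \<Longrightarrow> chB \<chi> j = of_real ((1 + of_int (\<epsilon> j) * value_root \<chi>) / 2) * chD \<chi>"
    using block_value[OF chi] by metis
  define t where "t = (\<Sum>j\<in>{1..m}. \<epsilon> j)"
  have "chD \<chi> = (\<Sum>j\<in>{1..m}. of_real ((1 + of_int (\<epsilon> j) * value_root \<chi>) / 2) * chD \<chi>)"
    using char_ext_family_union[OF fin sedf, of \<chi>] \<epsilon> by simp
  also have "\<dots> = of_real (\<Sum>j\<in>{1..m}. (1 + of_int (\<epsilon> j) * value_root \<chi>) / 2) * chD \<chi>"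
    by (simp only: sum_distrib_right of_real_sum)
  also have "(\<Sum>j\<in>{1..m}. (1 + of_int (\<epsilon> j) * value_root \<chi>) / 2) = (m + of_int t * value_root \<chi>) / 2"
    by (simp add: t_def sum.distrib sum_distrib_right flip: sum_divide_distrib)
  finally have "chD \<chi> = of_real ((m + of_int t * value_root \<chi>) / 2) * chD \<chi>" .
  moreover have "chD \<chi> \<noteq> 0" using chi by (simp add: chars_nonzero_def)
  ultimately have "complex_of_real ((m + of_int t * value_root \<chi>) / 2) = of_real 1" by simp
  then have "(m + of_int t * value_root \<chi>) / 2 = 1" by (simp only: of_real_eq_iff)
  then have e: "of_int t * value_root \<chi> = 2 - real m" by simp
  then have "t \<noteq> 0" using m by auto
  then have "value_root \<chi> = (2 - real m) / of_int t" using e by (simp add: field_simps)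
  then show ?thesis by simp
qed

lemma char_value:
  assumes "\<chi> \<in> chars_nonzero G m D" "simple_char_value G m lam D a b"
  shows "0 < a" "a < b" "value_root \<chi> = of_int b / of_int a"
  using char_value_pair_of_rational[of lam G \<chi> m D a b] value_root_rational[OF assms(1)] value_root_gt_1[OF assms(1)] assms
  unfolding value_root_def simple_char_value_def by auto

text \<open>Squaring \<open>value_root \<chi> = b / a\<close> and solving for the modulus. The
  result is the same for every \<open>\<chi>\<close> in \<open>chars_nonzero G m D\<close>, so
  Parseval becomes linear in the cardinalities.\<close>

lemma norm_chD:
  assumes "\<chi> \<in> chars_nonzero G m D" "simple_char_value G m lam D a b"
  shows "(cmod (chD \<chi>))\<^sup>2 =
    4 * real lam * (of_int a)\<^sup>2 / ((of_int b)\<^sup>2 - (of_int a)\<^sup>2)"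
proof -
  note ab = char_value[OF assms]
  have x: "(cmod (chD \<chi>))\<^sup>2 \<noteq> 0" using assms(1) by (simp add: chars_nonzero_def)
  have lt: "(real_of_int a)\<^sup>2 < (of_int b)\<^sup>2" using ab by (intro power_strict_mono) auto
  have "(value_root \<chi>)\<^sup>2 = 1 + 4 * real lam / (cmod (chD \<chi>))\<^sup>2"
    unfolding value_root_def by (intro real_sqrt_pow2 add_nonneg_nonneg divide_nonneg_nonneg) auto
  then have "(of_int b)\<^sup>2 / (of_int a)\<^sup>2 = 1 + 4 * real lam / (cmod (chD \<chi>))\<^sup>2"
    using ab by (simp add: power_divide)
  then show ?thesis using x lt ab by (simp add: field_simps)
qed

section \<open>The partition of the character group\<close>

text \<open>The sign in \<open>block_value\<close> for the first block decides the class, once the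
  square root is replaced by \<open>b / a\<close>.\<close>

lemma chars_nonzero_split:
  assumes ab: "simple_char_value G m lam D a b"
  shows "chars_nonzero G m D = chars_plus G m D a b \<union> chars_minus G m D a b"
proof (intro equalityI subsetI)
  fix \<chi> assume chi: "\<chi> \<in> chars_nonzero G m D"
  obtain \<epsilon> :: int where e: "\<bar>\<epsilon>\<bar> = 1" "chB \<chi> 1 = of_real ((1 + of_int \<epsilon> * value_root \<chi>) / 2) * chD \<chi>"
    using block_value[OF chi one_index] by blast
  have "\<epsilon> = 1 \<or> \<epsilon> = -1" using e(1) by arith
  moreover note v = char_value[OF chi ab]
  have "complex_of_real ((1 + of_int 1 * value_root \<chi>) / 2) = of_int (a + b) / of_int (2 * a)"
       "complex_of_real ((1 + of_int (-1) * value_root \<chi>) / 2) = of_int (a - b) / of_int (2 * a)"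
    using arg_cong[OF v(3), of complex_of_real] v(1) by (simp_all add: field_simps)
  ultimately have "chB \<chi> 1 = of_int (a + b) / of_int (2 * a) * chD \<chi> \<or>
      chB \<chi> 1 = of_int (a - b) / of_int (2 * a) * chD \<chi>"
    using e(2) by metis
  then show "\<chi> \<in> chars_plus G m D a b \<union> chars_minus G m D a b"
    using chi unfolding chars_plus_def chars_minus_def by blast
qed (auto simp: chars_plus_def chars_minus_def)

text \<open>A common member would have \<open>\<chi>(D) \<noteq> 0\<close>, so the two factors would
  agree and force \<open>b = 0\<close>, against \<open>0 < a < b\<close>.\<close>

lemma chars_plus_minus_disjoint:
  assumes ab: "simple_char_value G m lam D a b"
  shows "chars_plus G m D a b \<inter> chars_minus G m D a b = {}"
proof (rule equals0I)
  fix \<chi> assume "\<chi> \<in> chars_plus G m D a b \<inter> chars_minus G m D a b"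
  then have chi: "\<chi> \<in> chars_nonzero G m D" and
    "of_int (a + b) / of_int (2 * a) * chD \<chi> = of_int (a - b) / of_int (2 * a) * chD \<chi>"
    unfolding chars_plus_def chars_minus_def by auto
  moreover have "chD \<chi> \<noteq> 0" using chi by (simp add: chars_nonzero_def)
  moreover note v = char_value[OF chi ab]
  ultimately have "(of_int (a + b) :: complex) = of_int (a - b)" by simp
  then have "a + b = a - b" by (simp only: of_int_eq_iff)
  then show False using v by simp
qed

text \<open>Stated for arbitrary \<open>f\<close> because it is used with the constant 1 and with
  the squared moduli of \<open>\<chi>(D)\<close> and \<open>\<chi>(D\<^sub>1)\<close>.\<close>

lemma sum_over_characters:
  fixes f :: "('a \<Rightarrow> complex) \<Rightarrow> real"
  assumes ab: "simple_char_value G m lam D a b"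
  shows "sum f (characters G) = f (principal_char G) + sum f (chars_zero G m D) +
    sum f (chars_plus G m D a b) + sum f (chars_minus G m D a b)"
proof -
  note fc = finite_characters[OF fin]
  have z: "chars_zero G m D \<union> chars_nonzero G m D = characters G - {principal_char G}"
    "chars_zero G m D \<inter> chars_nonzero G m D = {}"
    by (auto simp: chars_zero_def chars_nonzero_def)
  have fz: "finite (chars_zero G m D)" "finite (chars_nonzero G m D)"
    using fc by (auto simp: chars_zero_def chars_nonzero_def)
  have "sum f (characters G) = f (principal_char G) + sum f (chars_zero G m D \<union> chars_nonzero G m D)"
    unfolding z using fc principal_char_in_characters by (rule sum.remove)
  also have "sum f (chars_zero G m D \<union> chars_nonzero G m D) =
      sum f (chars_zero G m D) + sum f (chars_nonzero G m D)"
    using fz z by (intro sum.union_disjoint)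
  also have "sum f (chars_nonzero G m D) = sum f (chars_plus G m D a b) + sum f (chars_minus G m D a b)"
    using fz chars_plus_minus_disjoint[OF ab] unfolding chars_nonzero_split[OF ab]
    by (intro sum.union_disjoint) auto
  finally show ?thesis by simp
qed

text \<open>If \<open>\<chi>(D) = 0\<close> for all nonprincipal \<open>\<chi>\<close>, then Parseval forces \<open>v = k m\<close>, and counting
  differences makes \<open>k m - 1\<close> a divisor of \<open>k\<^sup>2 (m - 1)\<close>, although it is coprime to \<open>k\<close> and
  exceeds \<open>m - 1\<close>.\<close>

lemma chars_nonzero_nonempty: "chars_nonzero G m D \<noteq> {}"
proof
  assume "chars_nonzero G m D = {}"
  then have z: "chD \<chi> = 0" if "\<chi> \<in> characters G - {principal_char G}" for \<chi>
    using that by (auto simp: chars_nonzero_def)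
  have "(\<Sum>\<chi>\<in>characters G. (cmod (chD \<chi>))\<^sup>2) = (cmod (chD (principal_char G)))\<^sup>2"
    using finite_characters[OF fin] principal_char_in_characters z by (subst sum.remove) auto
  then have "(real (k * m))\<^sup>2 = real v * real (k * m)"
    using parseval_indicator[OF fin union_subset] blocks(4)
    by (simp only: char_ext_principal[OF union_subset] norm_of_nat card_union)
  then have v: "v = k * m" using k m by (simp add: power2_eq_square flip: of_nat_mult)
  have "(int k)\<^sup>2 * (int m - 1) = int lam * (int v - 1)"
  proof -
    have "real_of_int ((int k)\<^sup>2 * (int m - 1)) = real_of_int (int lam * (int v - 1))"
      using count_differences by simp
    then show ?thesis by (simp only: of_int_eq_iff)
  qed
  then have "int k * int m - 1 dvd (int k)\<^sup>2 * (int m - 1)" by (simp add: v)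
  \<comment> \<open>Consecutive integers are coprime, so \<open>k * m - 1\<close> is coprime to
    \<open>k * m\<close> and hence to its factor \<open>k\<close>.\<close>
  moreover have "coprime (int k * int m - 1) ((int k)\<^sup>2)"
    using coprime_diff_one_left[of "int k * int m"] by simp
  ultimately have "int k * int m - 1 dvd int m - 1" by (simp add: coprime_dvd_mult_right_iff)
  then have "int k * int m - 1 \<le> int m - 1" using m by (intro zdvd_imp_le) auto
  moreover have "1 * int m < int k * int m" using k m by (intro mult_strict_right_mono) auto
  ultimately show False by simp
qed

section \<open>The modulus of the first block sum on each class\<close>

lemma norm_block_zero:
  assumes "\<chi> \<in> chars_zero G m D"
  shows "(cmod (chB \<chi> 1))\<^sup>2 = real lam"
proof -
  have "chB \<chi> 1 * cnj (chB \<chi> 1) = of_real (real lam)"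
    using nonprincipal_equation[OF _ one_index, of \<chi>] assms by (simp add: chars_zero_def)
  then show ?thesis by (simp only: of_real_eq_iff flip: complex_norm_square)
qed

text \<open>The class condition multiplies the modulus of \<open>\<chi>(D)\<close>, known from
  \<open>norm_chD\<close>, by \<open>(a + b) / (2 * a)\<close>.\<close>

lemma norm_block_plus:
  assumes chi: "\<chi> \<in> chars_plus G m D a b" and ab: "simple_char_value G m lam D a b"
  shows "(cmod (chB \<chi> 1))\<^sup>2 = real lam * (of_int b + of_int a) / (of_int b - of_int a)"
proof -
  have N: "\<chi> \<in> chars_nonzero G m D" using chi by (simp add: chars_plus_def)
  note v = char_value[OF N ab]
  have "chB \<chi> 1 = of_real ((of_int a + of_int b) / (2 * of_int a)) * chD \<chi>"
    using chi by (simp add: chars_plus_def)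
  then have "(cmod (chB \<chi> 1))\<^sup>2 = ((of_int a + of_int b) / (2 * of_int a))\<^sup>2 * (cmod (chD \<chi>))\<^sup>2"
    by (simp only: norm_mult norm_of_real power_mult_distrib power2_abs)
  \<comment> \<open>Factoring \<open>b\<^sup>2 - a\<^sup>2\<close> exposes the factor
    \<open>b + a\<close> that cancels against the square.\<close>
  also have "\<dots> = ((of_int a + of_int b) / (2 * of_int a))\<^sup>2 *
      (4 * real lam * (of_int a)\<^sup>2 / ((of_int b - of_int a) * (of_int b + of_int a)))"
    unfolding norm_chD[OF N ab] by (simp add: power2_eq_square algebra_simps)
  also have "\<dots> = real lam * (of_int b + of_int a) / (of_int b - of_int a)"
    using v by (simp add: divide_simps) (simp add: power2_eq_square algebra_simps)
  finally show ?thesis .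
qed

lemma norm_block_minus:
  assumes chi: "\<chi> \<in> chars_minus G m D a b" and ab: "simple_char_value G m lam D a b"
  shows "(cmod (chB \<chi> 1))\<^sup>2 = real lam * (of_int b - of_int a) / (of_int b + of_int a)"
proof -
  have N: "\<chi> \<in> chars_nonzero G m D" using chi by (simp add: chars_minus_def)
  note v = char_value[OF N ab]
  have "chB \<chi> 1 = of_real ((of_int a - of_int b) / (2 * of_int a)) * chD \<chi>"
    using chi by (simp add: chars_minus_def)
  then have "(cmod (chB \<chi> 1))\<^sup>2 = ((of_int a - of_int b) / (2 * of_int a))\<^sup>2 * (cmod (chD \<chi>))\<^sup>2"
    by (simp only: norm_mult norm_of_real power_mult_distrib power2_abs)
  also have "\<dots> = ((of_int a - of_int b) / (2 * of_int a))\<^sup>2 *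
      (4 * real lam * (of_int a)\<^sup>2 / ((of_int b - of_int a) * (of_int b + of_int a)))"
    unfolding norm_chD[OF N ab] by (simp add: power2_eq_square algebra_simps)
  also have "\<dots> = real lam * (of_int b - of_int a) / (of_int b + of_int a)"
    using v by (simp add: divide_simps) (simp add: power2_eq_square algebra_simps)
  finally show ?thesis .
qed

text \<open>Three instances of \<open>sum_over_characters\<close>, in the form of the hypotheses of
  \<open>character_count_system\<close>. The separate terms 1, \<open>(k * m)\<^sup>2\<close> and
  \<open>k\<^sup>2\<close> come from the principal character.\<close>

lemma character_counts:
  assumes ab: "simple_char_value G m lam D a b"
  defines "n0 \<equiv> real (card (chars_zero G m D))" and "p \<equiv> real (card (chars_plus G m D a b))"
    and "q \<equiv> real (card (chars_minus G m D a b))"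
  shows "real v = 1 + n0 + p + q"
    and "(real k * real m)\<^sup>2 +
      (p + q) * (4 * real lam * (of_int a)\<^sup>2 / ((of_int b)\<^sup>2 - (of_int a)\<^sup>2)) = real v * (real k * real m)"
    and "(real k)\<^sup>2 + n0 * real lam +
      p * (real lam * (of_int b + of_int a) / (of_int b - of_int a)) +
      q * (real lam * (of_int b - of_int a) / (of_int b + of_int a)) = real v * real k"
proof -
  show "real v = 1 + n0 + p + q"
    using sum_over_characters[OF ab, of "\<lambda>_. 1"] card_characters[OF fin] blocks(4)
    by (simp add: n0_def p_def q_def)
  define X where "X = 4 * real lam * (of_int a)\<^sup>2 / ((of_int b)\<^sup>2 - (of_int a)\<^sup>2)"
  have N: "(\<Sum>\<chi>\<in>chars_plus G m D a b. (cmod (chD \<chi>))\<^sup>2) = p * X"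
    "(\<Sum>\<chi>\<in>chars_minus G m D a b. (cmod (chD \<chi>))\<^sup>2) = q * X"
    using norm_chD[OF _ ab] by (simp_all add: X_def p_def q_def chars_plus_def chars_minus_def)
  have Z: "(\<Sum>\<chi>\<in>chars_zero G m D. (cmod (chD \<chi>))\<^sup>2) = 0"
    by (intro sum.neutral) (auto simp: chars_zero_def)
  have P: "(cmod (chD (principal_char G)))\<^sup>2 = (real k * real m)\<^sup>2"
    unfolding char_ext_principal[OF union_subset] card_union norm_of_nat by simp
  show "(real k * real m)\<^sup>2 +
      (p + q) * (4 * real lam * (of_int a)\<^sup>2 / ((of_int b)\<^sup>2 - (of_int a)\<^sup>2)) = real v * (real k * real m)"
    unfolding X_def[symmetric]
    using sum_over_characters[OF ab, of "\<lambda>\<chi>. (cmod (chD \<chi>))\<^sup>2"]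
    unfolding parseval_indicator[OF fin union_subset] card_union blocks(4) N Z P
    by (simp add: distrib_right)
  have Z1: "(\<Sum>\<chi>\<in>chars_zero G m D. (cmod (chB \<chi> 1))\<^sup>2) = n0 * real lam"
    using norm_block_zero by (simp add: n0_def)
  have P1: "(\<Sum>\<chi>\<in>chars_plus G m D a b. (cmod (chB \<chi> 1))\<^sup>2) =
      p * (real lam * (of_int b + of_int a) / (of_int b - of_int a))"
    using norm_block_plus[OF _ ab] by (simp add: p_def)
  have M1: "(\<Sum>\<chi>\<in>chars_minus G m D a b. (cmod (chB \<chi> 1))\<^sup>2) =
      q * (real lam * (of_int b - of_int a) / (of_int b + of_int a))"
    using norm_block_minus[OF _ ab] by (simp add: q_def)
  have "(cmod (chB (principal_char G) 1))\<^sup>2 = (real k)\<^sup>2"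
    by (simp only: char_ext_principal[OF blocks(1)[OF one_index]] norm_of_nat blocks(2)[OF one_index])
  then show "(real k)\<^sup>2 + n0 * real lam +
      p * (real lam * (of_int b + of_int a) / (of_int b - of_int a)) +
      q * (real lam * (of_int b - of_int a) / (of_int b + of_int a)) = real v * real k"
    using sum_over_characters[OF ab, of "\<lambda>\<chi>. (cmod (chB \<chi> 1))\<^sup>2"]
    unfolding parseval_indicator[OF fin blocks(1)[OF one_index]] blocks(2)[OF one_index] blocks(4)
      Z1 P1 M1 by linarith
qed

end

theorem theorem5p4:
  fixes G :: "('a, 'c) monoid_scheme"
    and v m k lam :: nat
    and D :: "nat \<Rightarrow> 'a set"
    and a b :: int
  assumes "comm_group G"
    and "finite (carrier G)"
    and "SEDF G v m k lam D"
    and "k > 1"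
    and "m > 2"
    and "simple_char_value G m lam D a b"
  shows "let v' = real v; m' = real m; k' = real k; a' = real_of_int a; b' = real_of_int b;
             n0 = (v' - 1) *
                    (1 - ((b'^2 - a'^2) * (v' - k' * m') * m') / (4 * a'^2 * k' * (m' - 1)));
             np = ((v' - 1) * (v' - k' * m') * (b'^2 - a'^2) * ((b' - a') * m' + 2 * a')) /
                    (8 * a'^2 * b' * k' * (m' - 1));
             nm = ((v' - 1) * (v' - k' * m') * (b'^2 - a'^2) * ((b' + a') * m' - 2 * a')) /
                    (8 * a'^2 * b' * k' * (m' - 1))
         in finite (chars_zero G m D) \<and> finite (chars_plus G m D a b) \<and>
            finite (chars_minus G m D a b) \<and>
            real (card (chars_zero G m D)) = n0 \<and>
            real (card (chars_plus G m D a b)) = np \<and>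
            real (card (chars_minus G m D a b)) = nm \<and>
            n0 \<in> \<nat> \<and> np \<in> \<nat> \<and> nm \<in> \<nat> \<and>
            card (chars_plus G m D a b) + card (chars_minus G m D a b) > 0"
proof -
  interpret nontrivial_SEDF G v m k lam D
    using assms(1-5) by (intro nontrivial_SEDF.intro nontrivial_SEDF_axioms.intro)
  note ab = assms(6)
  \<comment> \<open>A witness is required because \<open>0 < a\<close> and \<open>a < b\<close> are
    obtained from the pair of an actual \<open>\<chi>\<close> with
    \<open>\<chi>(D) \<noteq> 0\<close>; the same witness shows that the plus and minus classes are
    not both empty.\<close>
  obtain \<chi> where chi: "\<chi> \<in> chars_nonzero G m D" using chars_nonzero_nonempty by blast
  have pos: "0 < real_of_int a" "real_of_int a < real_of_int b"
    "0 < real k" "1 < real m" "1 < real v" "0 < real lam"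
    using char_value[OF chi ab] k m v_gt_1 blocks(5) by auto
  have fins: "finite (chars_zero G m D)" "finite (chars_plus G m D a b)" "finite (chars_minus G m D a b)"
    using finite_characters[OF fin]
    by (auto simp: chars_zero_def chars_plus_def chars_minus_def chars_nonzero_def)
  have "card (chars_plus G m D a b) + card (chars_minus G m D a b) > 0"
    using chi chars_nonzero_split[OF ab] fins by (auto simp: card_gt_0_iff)
  \<comment> \<open>Read from right to left, these equations turn each closed form into a
    cardinality, which makes membership in \<open>\<nat>\<close> immediate.\<close>
  moreover note counts = character_count_system[OF pos character_counts[OF ab] count_differences]
  ultimately show ?thesis
    unfolding Let_def counts[symmetric] using fins by simp
qed

end
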